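(* The logarithmic derivative $$H(z)=\frac{d}{dz}\log\left(\sum_{n=0}^\infty s(n+1)z^n\right)=\frac{\sum_{n=1}^\infty ns(n+1)z^{n-1}}{\sum_{n=0}^\infty s(n+1)z^n}$$ is a $2$-regular power series, and it is the unique formal power series satisfying the functional equation $$H(z)=\frac{1+2z}{1+z+z^2}+2zH(z^2).$$
   Context: The Stern sequence $s$ is defined by $s(0)=0$, $s(1)=1$, $s(2n)=s(n)$, $s(2n+1)=s(n)+s(n+1)$ for $n\geq1$. For an integer $k\geq 2$ and $0\leq i\leq k-1$, let $\rho(i)$ be the linear map on formal power series $\rho(i)\left(\sum_n a(n)z^n\right)=\sum_n a(i+nk)z^n$. The $k$-kernel of a power series $A$ (with coefficients in a commutative ring $R$, here $R=\mathbb Q$) is the smallest $R$-submodule of $R[[z]]$ containing $A$ and stable under $\rho(0),\dots,\rho(k-1)$; $A$ is $k$-regular if its $k$-kernel is finitely generated. *)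

theory Defs
  imports "HOL-Computational_Algebra.Computational_Algebra"
begin

function stern :: "nat \<Rightarrow> nat" where
  "stern 0 = 0"
| "stern (Suc 0) = 1"
| "n \<ge> 1 \<Longrightarrow> stern (2 * n) = stern n"
| "n \<ge> 1 \<Longrightarrow> stern (Suc (2 * n)) = stern n + stern (Suc n)"
proof goal_cases
  case (1 P x)
  show P
  proof (cases "even x")
    case True
    then obtain n where "x = 2 * n" by (elim evenE)
    then show P using 1(1) 1(3)[of n] by (cases "n = 0") simp_all
  next
    case False
    then obtain n where "x = 2 * n + 1" by (elim oddE)
    then show P using 1(2) 1(4)[of n] by (cases "n = 0") simp_all
  qed
next case 2 show ?case by simp
next case 3 then show ?case by simp
next case 4 then show ?case by simp
next case 5 then show ?case by simp
next case 6 then show ?case by simp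
next case 7 then show ?case by presburger
next case 8 then show ?case by simp
next case 9 then show ?case by simp
next case 10 then show ?case using Suc_double_not_eq_double by metis
next case 11 then show ?case by simp
qed
termination by (relation "measure id") auto

definition stern_fps :: "rat fps" where
  "stern_fps = Abs_fps (\<lambda>n. of_nat (stern (n + 1)))"

text \<open>The formal logarithm, meaningful for series with constant term \<open>1\<close>;
  \<open>fps_ln 1\<close> is the series of \<open>log (1 + z)\<close>.\<close>

definition fps_log :: "'a::field_char_0 fps \<Rightarrow> 'a fps" where
  "fps_log A = fps_ln 1 oo (A - 1)"

definition stern_log_deriv :: "rat fps" where
  "stern_log_deriv = fps_deriv (fps_log stern_fps)"

definition fps_scale :: "'a::comm_ring_1 \<Rightarrow> 'a fps \<Rightarrow> 'a fps" where
  "fps_scale c A = fps_const c * A"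

global_interpretation fps_module: module "fps_scale :: 'a::comm_ring_1 \<Rightarrow> 'a fps \<Rightarrow> 'a fps"
  defines fps_subspace = fps_module.subspace
    and fps_span = fps_module.span
proof
  fix a b :: 'a and x y :: "'a fps"
  show "fps_scale a (x + y) = fps_scale a x + fps_scale a y"
    unfolding fps_scale_def by (rule distrib_left)
  show "fps_scale (a + b) x = fps_scale a x + fps_scale b x"
    unfolding fps_scale_def fps_const_add[symmetric] by (rule distrib_right)
  show "fps_scale a (fps_scale b x) = fps_scale (a * b) x"
    unfolding fps_scale_def fps_const_mult[symmetric] by (rule mult.assoc[symmetric])
  show "fps_scale 1 x = x"
    by (simp add: fps_scale_def)
qed

definition fps_section :: "nat \<Rightarrow> nat \<Rightarrow> 'a fps \<Rightarrow> 'a fps" where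
  "fps_section k i A = Abs_fps (\<lambda>n. fps_nth A (i + n * k))"

definition section_stable :: "nat \<Rightarrow> 'a fps set \<Rightarrow> bool" where
  "section_stable k M \<longleftrightarrow> (\<forall>i<k. \<forall>A\<in>M. fps_section k i A \<in> M)"

definition k_kernel :: "nat \<Rightarrow> 'a::comm_ring_1 fps \<Rightarrow> 'a fps set" where
  "k_kernel k A = (\<lambda>M. fps_subspace M \<and> section_stable k M) hull {A}"

lemma k_kernel_least:
  "A \<in> k_kernel k A" "fps_subspace (k_kernel k A)" "section_stable k (k_kernel k A)"
  "A \<in> M \<Longrightarrow> fps_subspace M \<Longrightarrow> section_stable k M \<Longrightarrow> k_kernel k A \<subseteq> M"
proof -
  show "fps_subspace (k_kernel k A)"
    unfolding k_kernel_def hull_def by (rule fps_module.subspace_Inter) auto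
qed (auto simp: k_kernel_def hull_def section_stable_def)

definition k_regular :: "nat \<Rightarrow> 'a::comm_ring_1 fps \<Rightarrow> bool" where
  "k_regular k A \<longleftrightarrow> 2 \<le> k \<and> (\<exists>B. finite B \<and> fps_span B = k_kernel k A)"

end

(*
  Writing S for the shifted Stern series, the recurrence of s says S(z) = (1 + z + z^2) S(z^2), and
  taking logarithmic derivatives gives the functional equation.  A series D with
  D(z) = 2z D(z^2) has d(2m) = 0 and d(2m+1) = 2 d(m), so it vanishes, whence uniqueness.
  Let R = (1 + 2z) / (1 + z + z^2); its coefficients 1, 1, -2 repeat with period 3.  Reading off even and
  odd coefficients of the functional equation shows that the sections of H are Q and R + 2H, where
  Q has the periodic coefficients 1, -2, 1, and the sections of R and Q are Q, R and R, -R-Q.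
  Hence the 2-kernel of H is the span of H, R and Q.
*)

theory Submission
  imports Defs
begin

text \<open>Chain rule: log(1 + z) has derivative 1/(1 + z), and substituting A - 1 turns this into
  1/A. Constant term 1 makes the substitution legitimate and A a unit.\<close>

lemma fps_deriv_log:
  fixes A :: "'a::field_char_0 fps"
  assumes "fps_nth A 0 = 1"
  shows "fps_deriv (fps_log A) = fps_deriv A / A"
proof -
  have "fps_deriv (fps_log A) = (inverse (1 + fps_X) oo (A - 1)) * fps_deriv A"
    using assms by (simp add: fps_log_def fps_compose_deriv fps_ln_deriv)
  also have "inverse (1 + fps_X) oo (A - 1) = inverse A"
    using assms by (simp add: fps_inverse_compose fps_compose_add_distrib)
  finally show ?thesis
    using assms by (simp add: fps_divide_unit mult.commute)
qed

text \<open>The series 2z G(z^2) has only odd exponents, with coefficient 2 g(m) at 2m+1. So the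
  even section does not see it, while the odd section turns it into 2G.\<close>

lemma fps_section_0_double:
  fixes P G :: "'a::comm_ring_1 fps"
  shows "fps_section 2 0 (P + 2 * fps_X * (G oo fps_X ^ 2)) = fps_section 2 0 P"
  by (rule fps_ext)
    (simp add: fps_section_def mult.assoc fps_nth_compose_X_power fps_numeral_fps_const)

lemma fps_section_1_double:
  fixes P G :: "'a::comm_ring_1 fps"
  shows "fps_section 2 1 (P + 2 * fps_X * (G oo fps_X ^ 2)) = fps_section 2 1 P + 2 * G"
  by (rule fps_ext)
    (simp add: fps_section_def mult.assoc fps_nth_compose_X_power fps_numeral_fps_const)

lemma fps_section_add: "fps_section k i (A + B) = fps_section k i A + fps_section k i B"
  by (rule fps_ext) (simp add: fps_section_def)

lemma fps_section_scale: "fps_section k i (fps_scale c A) = fps_scale c (fps_section k i A)"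
  by (rule fps_ext) (simp add: fps_section_def fps_scale_def)

text \<open>Sections are linear, so stability needs checking on generators only.\<close>

lemma section_stable_span:
  fixes B :: "'a::comm_ring_1 fps set"
  assumes "\<And>i A. i < k \<Longrightarrow> A \<in> B \<Longrightarrow> fps_section k i A \<in> fps_span B"
  shows "section_stable k (fps_span B)"
  unfolding section_stable_def
proof (intro allI impI ballI)
  fix i A
  assume "i < k" and "A \<in> fps_span B"
  from this(2) show "fps_section k i A \<in> fps_span B"
  proof (induction rule: fps_module.span_induct_alt)
    case base
    have "fps_section k i (0 :: 'a fps) = 0"
      by (rule fps_ext) (simp add: fps_section_def)
    then show ?case by (simp add: fps_module.span_zero)
  next
    case (step c x y)
    then show ?case
      using assms[OF \<open>i < k\<close>]
      by (simp add: fps_section_add fps_section_scale fps_module.span_add fps_module.span_scale)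
  qed
qed

text \<open>Two minimality arguments: the span is a stable submodule containing A, and the kernel is
  a submodule containing B.\<close>

lemma k_kernel_eq_span:
  assumes "A \<in> B" "B \<subseteq> k_kernel k A"
    and "\<And>i C. i < k \<Longrightarrow> C \<in> B \<Longrightarrow> fps_section k i C \<in> fps_span B"
  shows "k_kernel k A = fps_span B"
proof (rule antisym)
  show "k_kernel k A \<subseteq> fps_span B"
    using assms by (intro k_kernel_least(4) section_stable_span)
      (auto simp: fps_module.subspace_span fps_module.span_base)
  show "fps_span B \<subseteq> k_kernel k A"
    using assms(2) k_kernel_least(2) by (rule fps_module.span_minimal)
qed

text \<open>Compare coefficients, which are shifted by one. At 2m the terms 1 and z^2 contribute
  s(m+1) + s(m) = s(2m+1); at 2m+1 only z contributes, giving s(m+1) = s(2m+2).\<close>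

lemma stern_fps_functional_equation:
  "stern_fps = (1 + fps_X + fps_X ^ 2) * (stern_fps oo fps_X ^ 2)"
proof (rule fps_ext)
  fix n
  show "fps_nth stern_fps n = fps_nth ((1 + fps_X + fps_X ^ 2) * (stern_fps oo fps_X ^ 2)) n"
  proof (cases "even n")
    case True
    then obtain m where n: "n = 2 * m" by (elim evenE)
    \<comment> \<open>At m = 0 the term z^2 contributes nothing, and the odd recurrence is only
      available from m = 1 on.\<close>
    show ?thesis
    proof (cases m)
      case 0
      then show ?thesis
        by (simp add: n stern_fps_def fps_nth_compose_X_power distrib_right fps_X_power_mult_nth)
    next
      case (Suc l)
      have "stern (Suc (2 * m)) = stern m + stern (Suc m)"
        using Suc by (intro stern.simps(4)) simp
      then show ?thesis
        using Suc
        by (simp add: n stern_fps_def fps_nth_compose_X_power distrib_right fps_X_power_mult_nth)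
    qed
  next
    case False
    then obtain m where n: "n = 2 * m + 1" by (elim oddE)
    have "stern (Suc (Suc (2 * m))) = stern (Suc m)"
      using stern.simps(3)[of "Suc m"] by simp
    then show ?thesis
      by (simp add: n stern_fps_def fps_nth_compose_X_power distrib_right fps_X_power_mult_nth)
  qed
qed

lemma stern_fps_nth_0: "fps_nth stern_fps 0 = 1"
  by (simp add: stern_fps_def)

lemma stern_log_deriv_eq: "stern_log_deriv = fps_deriv stern_fps / stern_fps"
  by (simp add: stern_log_deriv_def fps_deriv_log stern_fps_nth_0)

lemma fps_deriv_stern_fps:
  "fps_deriv stern_fps = Abs_fps (\<lambda>n. of_nat ((n + 1) * stern (n + 2)))"
  by (rule fps_ext) (simp add: stern_fps_def algebra_simps)

lemma stern_log_deriv_functional_equation: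
  "stern_log_deriv =
     (1 + 2 * fps_X) / (1 + fps_X + fps_X ^ 2) + 2 * fps_X * (stern_log_deriv oo fps_X ^ 2)"
proof -
  let ?S = stern_fps and ?p = "1 + fps_X + fps_X ^ 2 :: rat fps"
  \<comment> \<open>\<open>?U\<close> is S'(z^2), not the derivative of \<open>?T\<close>; the
    latter is 2z S'(z^2).\<close>
  let ?T = "?S oo fps_X ^ 2" and ?U = "fps_deriv ?S oo fps_X ^ 2"
  have T0: "fps_nth ?T 0 = 1" and p0: "fps_nth ?p 0 = 1"
    by (simp_all add: stern_fps_nth_0)
  then have inv: "?T * inverse ?T = 1" "?p * inverse ?p = 1"
    by (simp_all add: inverse_mult_eq_1')
  have H: "stern_log_deriv = fps_deriv ?S * inverse ?S"
    by (simp add: stern_log_deriv_eq fps_divide_unit stern_fps_nth_0)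
  have H2: "stern_log_deriv oo fps_X ^ 2 = ?U * inverse ?T"
    unfolding H by (simp add: fps_compose_mult_distrib fps_inverse_compose stern_fps_nth_0)
  have dS: "fps_deriv ?S = (1 + 2 * fps_X) * ?T + ?p * (2 * fps_X * ?U)"
    using arg_cong[OF stern_fps_functional_equation, of fps_deriv]
    by (simp add: fps_compose_deriv fps_deriv_power fps_numeral_fps_const algebra_simps)
  have iS: "inverse ?S = inverse ?p * inverse ?T"
    using arg_cong[OF stern_fps_functional_equation, of inverse] by (simp only: fps_inverse_mult)
  have "stern_log_deriv =
      ((1 + 2 * fps_X) * ?T + ?p * (2 * fps_X * ?U)) * (inverse ?p * inverse ?T)"
    unfolding H by (rule arg_cong2[OF dS iS])
  \<comment> \<open>Grouped so that T/T and p/p cancel, leaving p'/p + 2z U/T, where U/T is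
    H(z^2).\<close>
  also have "\<dots> = (1 + 2 * fps_X) * inverse ?p * (?T * inverse ?T)
      + 2 * fps_X * (?U * inverse ?T) * (?p * inverse ?p)"
    by (simp only: algebra_simps)
  finally show ?thesis
    using p0 by (simp only: inv mult_1_right H2) (simp add: fps_divide_unit)
qed

text \<open>Strong induction replaces the difference D: the coefficient at n depends only on P and,
  for odd n, on the coefficient at n div 2, which is smaller than n.\<close>

lemma fps_double_fixpoint_unique:
  fixes G H P :: "'a::comm_ring_1 fps"
  assumes G: "G = P + 2 * fps_X * (G oo fps_X ^ 2)"
    and H: "H = P + 2 * fps_X * (H oo fps_X ^ 2)"
  shows "G = H"
proof (rule fps_ext)
  fix n
  show "fps_nth G n = fps_nth H n"
  proof (induction n rule: less_induct)
    case (less n)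
    have *: "fps_nth F n = fps_nth P n + (if odd n then 2 * fps_nth F (n div 2) else 0)"
      if "F = P + 2 * fps_X * (F oo fps_X ^ 2)" for F :: "'a fps"
    proof -
      have "fps_nth F n = fps_nth (P + 2 * fps_X * (F oo fps_X ^ 2)) n"
        using that by simp
      then show ?thesis
        by (cases n)
          (simp_all add: mult.assoc fps_nth_compose_X_power fps_numeral_fps_const)
    qed
    show ?case
    proof (cases "odd n")
      case True
      then have "n div 2 < n" by (cases n) auto
      then show ?thesis using *[OF G] *[OF H] less.IH by simp
    next
      case False
      then show ?thesis using *[OF G] *[OF H] by simp
    qed
  qed
qed

text \<open>The index j places the -2 within the period: j = 2 gives R, j = 1 gives Q and j = 0
  gives -R-Q.\<close>

definition fps_periodic3 :: "nat \<Rightarrow> rat fps" where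
  "fps_periodic3 j = Abs_fps (\<lambda>n. if n mod 3 = j then -2 else 1)"

text \<open>Any three consecutive coefficients sum to 0, so multiplying by 1 + z + z^2 kills
  everything from z^2 on; the first two coefficients of the product are 1 and 1 + 1.\<close>

lemma fps_periodic3_2:
  "(1 + 2 * fps_X) / (1 + fps_X + fps_X ^ 2) = fps_periodic3 2"
proof -
  let ?p = "1 + fps_X + fps_X ^ 2 :: rat fps"
  have "fps_periodic3 2 * ?p = 1 + 2 * fps_X"
  proof (rule fps_ext)
    fix n
    consider "n = 0" | "n = 1" | m where "n = Suc (Suc m)"
      by (metis One_nat_def not0_implies_Suc)
    then show "fps_nth (fps_periodic3 2 * ?p) n = fps_nth (1 + 2 * fps_X) n"
    proof cases
      case 3
      have "m mod 3 = 0 \<or> m mod 3 = 1 \<or> m mod 3 = 2" by presburger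
      then show ?thesis
        by (auto simp: 3 fps_periodic3_def distrib_left fps_X_power_mult_right_nth
            fps_numeral_fps_const mod_Suc)
    qed (simp_all add: fps_periodic3_def distrib_left fps_X_power_mult_right_nth
            fps_numeral_fps_const)
  qed
  moreover have "?p \<noteq> 0"
  proof
    assume "?p = 0"
    then have "fps_nth ?p 0 = 0" by (simp only: fps_zero_nth)
    then show False by simp
  qed
  ultimately show ?thesis
    by (metis nonzero_mult_div_cancel_right)
qed

text \<open>As 2 is invertible mod 3, the condition i + 2n = j mod 3 selects one residue class of n,
  so a section only moves the -2.\<close>

lemma fps_section_periodic3:
  "fps_section 2 0 (fps_periodic3 2) = fps_periodic3 1"
  "fps_section 2 1 (fps_periodic3 2) = fps_periodic3 2"
  "fps_section 2 0 (fps_periodic3 1) = fps_periodic3 2"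
  "fps_section 2 1 (fps_periodic3 1) = fps_scale (-1) (fps_periodic3 2 + fps_periodic3 1)"
proof -
  have eqs: "(n * 2) mod 3 = 2 \<longleftrightarrow> n mod 3 = 1" "(1 + n * 2) mod 3 = 2 \<longleftrightarrow> n mod 3 = 2"
    "(n * 2) mod 3 = 1 \<longleftrightarrow> n mod 3 = 2" "(1 + n * 2) mod 3 = 1 \<longleftrightarrow> n mod 3 = 0" for n :: nat
    by presburger+
  have three: "n mod 3 = 0 \<or> n mod 3 = 1 \<or> n mod 3 = 2" for n :: nat
    by presburger
  show "fps_section 2 0 (fps_periodic3 2) = fps_periodic3 1"
    "fps_section 2 1 (fps_periodic3 2) = fps_periodic3 2"
    "fps_section 2 0 (fps_periodic3 1) = fps_periodic3 2"
    unfolding fps_section_def fps_periodic3_def fps_nth_Abs_fps add_0 eqs by (rule refl)+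
  \<comment> \<open>Here the -2 lands on class 0; writing the result through R and Q avoids a
    further generator.\<close>
  show "fps_section 2 1 (fps_periodic3 1) = fps_scale (-1) (fps_periodic3 2 + fps_periodic3 1)"
    unfolding fps_section_def fps_scale_def fps_periodic3_def fps_eq_iff fps_nth_Abs_fps
      fps_mult_left_const_nth fps_add_nth eqs
    using three by auto
qed

lemma k_regular_stern_log_deriv: "k_regular 2 stern_log_deriv"
proof -
  let ?H = stern_log_deriv and ?R = "fps_periodic3 2" and ?Q = "fps_periodic3 1"
  let ?K = "k_kernel 2 ?H" and ?B = "{?H, ?R, ?Q}"
  have FE: "?H = ?R + 2 * fps_X * (?H oo fps_X ^ 2)"
    using stern_log_deriv_functional_equation by (simp only: fps_periodic3_2)
  have H0: "fps_section 2 0 ?H = ?Q"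
    using arg_cong[OF FE, of "fps_section 2 0"]
    by (simp only: fps_section_0_double fps_section_periodic3)
  have "fps_section 2 1 ?H = ?R + 2 * ?H"
    using arg_cong[OF FE, of "fps_section 2 1"]
    by (simp only: fps_section_1_double fps_section_periodic3)
  \<comment> \<open>The factor 2 becomes a scalar, so that closure of the span under scaling
    applies.\<close>
  then have H1: "fps_section 2 1 ?H = ?R + fps_scale 2 ?H"
    by (simp add: fps_scale_def fps_numeral_fps_const)
  have stable: "fps_section 2 i A \<in> ?K" if "i < 2" "A \<in> ?K" for i A
    using that k_kernel_least(3) by (auto simp: section_stable_def)
  have HK: "?H \<in> ?K" by (rule k_kernel_least(1))
  \<comment> \<open>Q and R are reached from H by taking the even section once and twice.\<close>
  have QK: "?Q \<in> ?K" using stable[OF pos2 HK] by (simp only: H0)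
  have RK: "?R \<in> ?K" using stable[OF pos2 QK] by (simp only: fps_section_periodic3)
  have "?K = fps_span ?B"
  proof (rule k_kernel_eq_span)
    show "?H \<in> ?B" by simp
    show "?B \<subseteq> ?K" using HK QK RK by simp
  next
    fix i :: nat and C
    assume "i < 2" "C \<in> ?B"
    then have i: "i = 0 \<or> i = 1" and C: "C = ?H \<or> C = ?R \<or> C = ?Q" by auto
    have "?H \<in> fps_span ?B" "?R \<in> fps_span ?B" "?Q \<in> fps_span ?B"
      by (simp_all add: fps_module.span_base)
    then have "fps_section 2 0 C \<in> fps_span ?B" "fps_section 2 1 C \<in> fps_span ?B"
      using C unfolding atomize_conj
      by (elim disjE; simp only: H0 H1 fps_section_periodic3)
        (intro conjI fps_module.span_add fps_module.span_scale; assumption)+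
    then show "fps_section 2 i C \<in> fps_span ?B" using i by blast
  qed
  then show ?thesis
    unfolding k_regular_def by (intro conjI exI[of _ ?B]) simp_all
qed

theorem mainTheorem4:
  shows "stern_log_deriv =
           Abs_fps (\<lambda>n. of_nat ((n + 1) * stern (n + 2))) / stern_fps
       \<and> k_regular 2 stern_log_deriv
       \<and> (\<forall>G :: rat fps.
            G = (1 + 2 * fps_X) / (1 + fps_X + fps_X ^ 2) + 2 * fps_X * (G oo fps_X ^ 2)
              \<longleftrightarrow> G = stern_log_deriv)"
proof (intro conjI allI iffI)
  show "stern_log_deriv = Abs_fps (\<lambda>n. of_nat ((n + 1) * stern (n + 2))) / stern_fps"
    by (simp only: stern_log_deriv_eq fps_deriv_stern_fps)
  show "k_regular 2 stern_log_deriv" by (rule k_regular_stern_log_deriv)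
next
  fix G :: "rat fps"
  assume "G = (1 + 2 * fps_X) / (1 + fps_X + fps_X ^ 2) + 2 * fps_X * (G oo fps_X ^ 2)"
  then show "G = stern_log_deriv"
    using stern_log_deriv_functional_equation by (rule fps_double_fixpoint_unique)
next
  fix G :: "rat fps"
  assume "G = stern_log_deriv"
  then show "G = (1 + 2 * fps_X) / (1 + fps_X + fps_X ^ 2) + 2 * fps_X * (G oo fps_X ^ 2)"
    using stern_log_deriv_functional_equation by simp
qed

end
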